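(* Assume that the pairwise stationarity assumption stated in the context holds. Let $t>0$ and $\tau\ge0$ be fixed. If $\mathbb E(N_{t+\tau})<\infty$, then $$\mathbb E[N_tN_{t+\tau}]=\mathbb E[N_t]+\mathbb E[N_{t+\tau}]-1+\sum_{n=1}^\infty\sum_{m=1}^\infty\sum_{k=0}^{\min(n,m)-1}\mathbb E\Big[A_{n,m,k}\,\mathbf 1_{\{S_{n-1}\le t,\ S^{(k)}_{m-1}\le t+\tau\}}\Big].$$
   Context: Branching model. $(\mathbb X,\mathcal X)$ is a measurable space, $\xi:\mathbb X\to[0,+\infty)$ and $\kappa:\mathbb X\to\{2,3,\dots\}$ are measurable functions, and $(X_n)_{n\ge 0}$ is an $\mathbb X$-valued process. Cells are labelled by finite sequences $v=(k_1,\dots,k_n)$ of positive integers ($n$ is the generation of $v$; the empty sequence labels the single initial cell, born at time $0$). To each label $v$ is attached an $\mathbb X$-valued random variable $X_v$ in such a way that, along every infinite line of descent $(v_n)_{n\ge0}$ ($v_0=\emptyset$ and $v_{n+1}$ is obtained from $v_n$ by appending one positive integer), the process $(X_{v_n})_{n\ge 0}$ has the same law as $(X_n)_{n\ge 0}$. A cell $v$ has lifetime $\xi(X_v)$ and at the end of its lifetime it splits into $\kappa(X_v)$ new cells, labelled by appending $1,\dots,\kappa(X_v)$ to $v$. Thus $v=(k_1,\dots,k_n)$ actually occurs iff $k_{i+1}\le\kappa(X_{(k_1,\dots,k_i)})$ for $0\le i<n$, and it is then alive at time $t$ iff $\sum_{i=0}^{n-1}\xi(X_{(k_1,\dots,k_i)})\le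 t<\sum_{i=0}^{n}\xi(X_{(k_1,\dots,k_i)})$. $N_t$ is the number of cells alive at time $t$. Pairwise stationarity assumption. For each integer $k\ge0$ there is a process $X^{(k)}=(X^{(k)}_n)_{n\ge0}$ (defined jointly with $X=(X_n)_{n\ge0}$) such that $(X^{(k)}_n)_{0\le n\le k}=(X_n)_{0\le n\le k}$ a.s., $(X^{(k)}_n)_{n\ge0}$ has the same law as $(X_n)_{n\ge0}$, and, for every pair of lines of cells $((v_n)_n,(w_n)_n)$ coinciding up to the $k$-th generation but not at the $(k+1)$-th generation, the corresponding pair of sequences of parameters has the same distribution as $(X,X^{(k)})$. Notation. $S_n:=\sum_{j=0}^n\xi(X_j)$, $S^{(k)}_n:=\sum_{j=0}^n\xi(X^{(k)}_j)$ and, for integers $n,m\ge1$ and $0\le k\le\min(n,m)-1$, $$A_{n,m,k}=\Big(\prod_{i=0}^{n-2}\kappa(X_i)\Big)\Big(\prod_{j=\min(k+1,n-1)}^{m-2}\kappa(X^{(k)}_j)\Big)\Big(\prod_{j\in\{k\}\setminus\{n-1,m-1\}}(\kappa(X_j)-1)\Big)(\kappa(X_{n-1})-1)(\kappa(X^{(k)}_{m-1})-1),$$ empty products being equal to $1$.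
   Formalization: The formal theorem also assumes no explosion: almost surely some S_n exceeds t+τ. Without it the identity fails, e.g. for deterministic lifetimes 2^{-n-1} in generation n, κ=2, t=τ=1/2, where N_{t+τ}=0 but N_t=2. *)

theory Defs
  imports "HOL-Probability.Probability"
begin

text \<open>
  A cell is labelled by a list of positive integers; its generation is the length of the list.
  A random field \<open>Z\<close> attaches a parameter \<open>Z v \<omega>\<close> to every label, whether or not the cell
  actually occurs.
\<close>

definition labels :: "nat list set" where
  "labels = {v. \<forall>k\<in>set v. 1 \<le> k}"

definition line_of_descent :: "(nat \<Rightarrow> nat list) \<Rightarrow> bool" where
  "line_of_descent v \<longleftrightarrow> v 0 = [] \<and> (\<forall>n. \<exists>j\<ge>1. v (Suc n) = v n @ [j])"

definition coincide_exactly_up_to :: "nat \<Rightarrow> (nat \<Rightarrow> nat list) \<Rightarrow> (nat \<Rightarrow> nat list) \<Rightarrow> bool" where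
  "coincide_exactly_up_to k v w \<longleftrightarrow> (\<forall>i\<le>k. v i = w i) \<and> v (Suc k) \<noteq> w (Suc k)"

text \<open>The product sigma-algebra on sequences of parameters.\<close>

abbreviation seq_space :: "'x measure \<Rightarrow> (nat \<Rightarrow> 'x) measure" where
  "seq_space E \<equiv> Pi\<^sub>M UNIV (\<lambda>_. E)"

text \<open>
  The field \<open>Z\<close> lives on \<open>M\<close>, the reference process \<open>X\<close> on a possibly different probability
  space \<open>P\<close>; the two are related only through their laws.
\<close>

locale branching_model = tree: prob_space M + ref: prob_space P
  for E :: "'x measure" and \<xi> :: "'x \<Rightarrow> real" and \<kappa> :: "'x \<Rightarrow> nat"
    and M :: "'w measure" and Z :: "nat list \<Rightarrow> 'w \<Rightarrow> 'x"
    and P :: "'p measure" and X :: "nat \<Rightarrow> 'p \<Rightarrow> 'x" +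
  assumes measurable_lifetime: "\<xi> \<in> borel_measurable E"
    and lifetime_nonneg: "\<And>x. x \<in> space E \<Longrightarrow> 0 \<le> \<xi> x"
    and measurable_offspring: "\<kappa> \<in> measurable E (count_space UNIV)"
    and offspring_ge_2: "\<And>x. x \<in> space E \<Longrightarrow> 2 \<le> \<kappa> x"
    and measurable_field: "\<And>v. v \<in> labels \<Longrightarrow> Z v \<in> measurable M E"
    and measurable_process: "\<And>n. X n \<in> measurable P E"
    and law_of_line: "\<And>v. line_of_descent v \<Longrightarrow>
          distr M (seq_space E) (\<lambda>\<omega>. (\<lambda>n. Z (v n) \<omega>)) =
          distr P (seq_space E) (\<lambda>\<omega>. (\<lambda>n. X n \<omega>))"

text \<open>\<open>Y k n\<close> is the $n$-th term of the process $X^{(k)}$.\<close>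

locale pairwise_stationary_model = branching_model E \<xi> \<kappa> M Z P X
  for E :: "'x measure" and \<xi> :: "'x \<Rightarrow> real" and \<kappa> :: "'x \<Rightarrow> nat"
    and M :: "'w measure" and Z :: "nat list \<Rightarrow> 'w \<Rightarrow> 'x"
    and P :: "'p measure" and X :: "nat \<Rightarrow> 'p \<Rightarrow> 'x" +
  fixes Y :: "nat \<Rightarrow> nat \<Rightarrow> 'p \<Rightarrow> 'x"
  assumes measurable_copy: "\<And>k n. Y k n \<in> measurable P E"
    and copy_coincides: "\<And>k. AE \<omega> in P. \<forall>n\<le>k. Y k n \<omega> = X n \<omega>"
    and law_of_copy: "\<And>k. distr P (seq_space E) (\<lambda>\<omega>. (\<lambda>n. Y k n \<omega>)) =
                           distr P (seq_space E) (\<lambda>\<omega>. (\<lambda>n. X n \<omega>))"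
    and law_of_pair: "\<And>k v w. line_of_descent v \<Longrightarrow> line_of_descent w \<Longrightarrow>
          coincide_exactly_up_to k v w \<Longrightarrow>
          distr M (seq_space E \<Otimes>\<^sub>M seq_space E) (\<lambda>\<omega>. (\<lambda>n. Z (v n) \<omega>, \<lambda>n. Z (w n) \<omega>)) =
          distr P (seq_space E \<Otimes>\<^sub>M seq_space E) (\<lambda>\<omega>. (\<lambda>n. X n \<omega>, \<lambda>n. Y k n \<omega>))"

text \<open>Here \<open>z v\<close> is the parameter of \<open>v\<close> in one fixed realisation.\<close>

definition occurs :: "('x \<Rightarrow> nat) \<Rightarrow> (nat list \<Rightarrow> 'x) \<Rightarrow> nat list \<Rightarrow> bool" where
  "occurs \<kappa> z v \<longleftrightarrow> v \<in> labels \<and> (\<forall>i<length v. v ! i \<le> \<kappa> (z (take i v)))"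

definition birth_time :: "('x \<Rightarrow> real) \<Rightarrow> (nat list \<Rightarrow> 'x) \<Rightarrow> nat list \<Rightarrow> real" where
  "birth_time \<xi> z v = (\<Sum>i<length v. \<xi> (z (take i v)))"

definition division_time :: "('x \<Rightarrow> real) \<Rightarrow> (nat list \<Rightarrow> 'x) \<Rightarrow> nat list \<Rightarrow> real" where
  "division_time \<xi> z v = (\<Sum>i\<le>length v. \<xi> (z (take i v)))"

definition alive_cells ::
    "('x \<Rightarrow> real) \<Rightarrow> ('x \<Rightarrow> nat) \<Rightarrow> (nat list \<Rightarrow> 'x) \<Rightarrow> real \<Rightarrow> nat list set" where
  "alive_cells \<xi> \<kappa> z t =
     {v. occurs \<kappa> z v \<and> birth_time \<xi> z v \<le> t \<and> t < division_time \<xi> z v}"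

text \<open>
  The number of cells alive, with value \<open>\<infinity>\<close> if there are infinitely many (\<open>card\<close> would give 0).
\<close>

definition num_alive ::
    "('x \<Rightarrow> real) \<Rightarrow> ('x \<Rightarrow> nat) \<Rightarrow> (nat list \<Rightarrow> 'w \<Rightarrow> 'x) \<Rightarrow> real \<Rightarrow> 'w \<Rightarrow> ennreal" where
  "num_alive \<xi> \<kappa> Z t \<omega> =
     emeasure (count_space UNIV) (alive_cells \<xi> \<kappa> (\<lambda>v. Z v \<omega>) t)"

definition lifetime_sum :: "('x \<Rightarrow> real) \<Rightarrow> (nat \<Rightarrow> 'x) \<Rightarrow> nat \<Rightarrow> real" where
  "lifetime_sum \<xi> x n = (\<Sum>j\<le>n. \<xi> (x j))"

text \<open>
  No explosion by time \<open>s\<close>: almost surely, the lifetimes along a line of descent do not accumulate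
  at or before \<open>s\<close>. Otherwise infinitely many divisions may leave no cell alive at time \<open>s\<close>: with
  \<open>\<kappa> = 2\<close> and deterministic lifetimes $2^{-n-1}$ in generation $n$, no cell is alive from time 1 on.
\<close>

definition no_explosion_by ::
    "'p measure \<Rightarrow> ('x \<Rightarrow> real) \<Rightarrow> (nat \<Rightarrow> 'p \<Rightarrow> 'x) \<Rightarrow> real \<Rightarrow> bool" where
  "no_explosion_by P \<xi> X s \<longleftrightarrow> (AE \<omega> in P. \<exists>n. s < lifetime_sum \<xi> (\<lambda>j. X j \<omega>) n)"

text \<open>
  The weight $A_{n,m,k}$ for \<open>n, m \<ge> 1\<close>. The products up to $n-2$ and $m-2$ are written with
  half-open index ranges, so that they are empty for \<open>n = 1\<close>, \<open>m = 1\<close>.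
\<close>

definition pair_weight ::
    "('x \<Rightarrow> nat) \<Rightarrow> (nat \<Rightarrow> 'x) \<Rightarrow> (nat \<Rightarrow> 'x) \<Rightarrow> nat \<Rightarrow> nat \<Rightarrow> nat \<Rightarrow> nat" where
  "pair_weight \<kappa> x y n m k =
     (\<Prod>i\<in>{0..<n - 1}. \<kappa> (x i)) *
     (\<Prod>j\<in>{min (k + 1) (n - 1)..<m - 1}. \<kappa> (y j)) *
     (\<Prod>j\<in>{k} - {n - 1, m - 1}. \<kappa> (x j) - 1) *
     (\<kappa> (x (n - 1)) - 1) * (\<kappa> (y (m - 1)) - 1)"

end

theory Submission
  imports Defs
begin

text \<open>
  Replacing a cell by its children raises the population by \<open>\<kappa> - 1\<close>, so as long as only finitely many
  cells are born by time \<open>s\<close>, $N_s = 1 + \sum_v (\kappa(X_v) - 1)$ over the cells \<open>v\<close> divided by time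
  \<open>s\<close>. Almost surely the finiteness of $N_{t+\tau}$ entails that of the born cells, because
  no cell can have a progeny that dies out by explosion. Multiplying the identities for \<open>t\<close> and
  \<open>t + \<tau>\<close> leaves the expectation of a sum over pairs of divided cells. Grouped by the two
  generations and the generation \<open>k\<close> of the last common ancestor, each summand has the law prescribed
  by $(X, X^{(k)})$, and $A_{n,m,k}$ counts the pairs with their weights.
\<close>

section \<open>Pairs of labels with a given branching generation\<close>

text \<open>The admissible letters may vary with the position, so that a letter can later be
  prescribed or forbidden at selected positions.\<close>

lemma card_lists_nth_mem:
  assumes "\<And>i. i < n \<Longrightarrow> finite (C i)"
  shows "finite {w. length w = n \<and> (\<forall>i<n. w ! i \<in> C i)}"
    and "card {w. length w = n \<and> (\<forall>i<n. w ! i \<in> C i)} = (\<Prod>i<n. card (C i))"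
proof -
  have "finite {w. length w = n \<and> (\<forall>i<n. w ! i \<in> C i)} \<and>
      card {w. length w = n \<and> (\<forall>i<n. w ! i \<in> C i)} = (\<Prod>i<n. card (C i))"
    using assms
  proof (induction n)
    case 0
    have "{w. length w = 0 \<and> (\<forall>i<0. w ! i \<in> C i)} = {[]}" by auto
    then show ?case by simp
  next
    case (Suc n)
    let ?L = "\<lambda>n. {w. length w = n \<and> (\<forall>i<n. w ! i \<in> C i)}"
    have eq: "?L (Suc n) = (\<lambda>(w, x). w @ [x]) ` (?L n \<times> C n)"
    proof safe
      fix w assume w: "length w = Suc n" "\<forall>i<Suc n. w ! i \<in> C i"
      then obtain u x where "w = u @ [x]" by (metis length_Suc_conv_rev)
      with w have "length u = n" "\<forall>i<n. u ! i \<in> C i" "x \<in> C n"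
        by (auto simp: nth_append less_Suc_eq)
      then show "w \<in> (\<lambda>(w, x). w @ [x]) ` (?L n \<times> C n)" using \<open>w = u @ [x]\<close> by auto
    qed (auto simp: nth_append less_Suc_eq)
    have inj: "inj_on (\<lambda>(w, x). w @ [x]) (?L n \<times> C n)"
      by (auto simp: inj_on_def)
    show ?case
      unfolding eq card_image[OF inj] using Suc by (simp add: card_cartesian_product)
  qed
  then show "finite {w. length w = n \<and> (\<forall>i<n. w ! i \<in> C i)}"
    and "card {w. length w = n \<and> (\<forall>i<n. w ! i \<in> C i)} = (\<Prod>i<n. card (C i))" by auto
qed

text \<open>This characterises \<open>k\<close> as the length of the longest common prefix, the
  generation of the last common ancestor. The guards cover the case where one label is a prefix of
  the other; then \<open>k\<close> is the length of the shorter one.\<close>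

definition branch_at :: "nat \<Rightarrow> 'a list \<Rightarrow> 'a list \<Rightarrow> bool" where
  "branch_at k v w \<longleftrightarrow> k \<le> length v \<and> k \<le> length w \<and> take k v = take k w \<and>
     (k < length v \<longrightarrow> k < length w \<longrightarrow> v ! k \<noteq> w ! k)"

lemma branch_at_Cons: "branch_at (Suc k) (a # v) (b # w) \<longleftrightarrow> a = b \<and> branch_at k v w"
  by (auto simp: branch_at_def)

text \<open>A common first letter shifts the branching generation by one, and distinct first letters
  force it to be 0. Uniqueness is what turns the grouping by \<open>k\<close> into a partition of
  all pairs of labels.\<close>

lemma ex1_branch_at: "\<exists>!k. branch_at k v w"
proof (induction v arbitrary: w)
  case Nil
  then show ?case by (auto simp: branch_at_def)
next
  case (Cons a v)
  show ?case
  proof (cases w)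
    case Nil
    then show ?thesis by (auto simp: branch_at_def)
  next
    case (Cons b u)
    show ?thesis
    proof (cases "a = b")
      case True
      obtain k where k: "\<And>j. branch_at j v u \<longleftrightarrow> j = k"
        using Cons.IH[of u] by metis
      have "\<not> branch_at 0 (a # v) (b # u)" using True by (simp add: branch_at_def)
      then have "branch_at j (a # v) (b # u) \<longleftrightarrow> j = Suc k" for j
        by (cases j) (simp_all add: k True branch_at_Cons)
      then show ?thesis using Cons by simp
    next
      case False
      then have "branch_at j (a # v) (b # u) \<longleftrightarrow> j = 0" for j
        by (cases j) (auto simp: branch_at_Cons branch_at_def)
      then show ?thesis using Cons by simp
    qed
  qed
qed

definition label_pairs :: "nat \<Rightarrow> nat \<Rightarrow> nat \<Rightarrow> (nat list \<times> nat list) set" where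
  "label_pairs n m k =
     {(v, w). v \<in> labels \<and> w \<in> labels \<and> length v = n \<and> length w = m \<and> branch_at k v w}"

lemma labels_iff_nth: "v \<in> labels \<longleftrightarrow> (\<forall>i<length v. 1 \<le> v ! i)"
  by (auto simp: labels_def all_set_conv_all_nth)

lemma branch_at_iff_nth:
  assumes "length v = n" "length w = m" "k \<le> n" "k \<le> m"
  shows "branch_at k v w \<longleftrightarrow> (\<forall>i<k. w ! i = v ! i) \<and> (k < n \<longrightarrow> k < m \<longrightarrow> w ! k \<noteq> v ! k)"
  using assms unfolding branch_at_def
  by (auto simp: list_eq_iff_nth_eq)

text \<open>The branching letter of \<open>w\<close> avoids the one of \<open>v\<close> only if both labels reach beyond
  generation \<open>k\<close>; this produces the index sets of the last two products.\<close>

lemma card_bounded_label_pairs: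
  fixes a b :: "nat \<Rightarrow> nat"
  assumes k: "k \<le> n" "k \<le> m" and ab: "\<And>i. i \<le> k \<Longrightarrow> a i = b i"
  defines "Q \<equiv> {(v, w) \<in> label_pairs n m k. (\<forall>i<n. v ! i \<le> a i) \<and> (\<forall>i<m. w ! i \<le> b i)}"
  shows "finite Q"
    and "card Q = (\<Prod>i\<in>{0..<n}. a i) * (\<Prod>j\<in>{min (k + 1) n..<m}. b j) * (\<Prod>j\<in>{k} - {n, m}. a j - 1)"
proof -
  define V where "V = {v. length v = n \<and> (\<forall>i<n. v ! i \<in> {1..a i})}"
  \<comment> \<open>Letters allowed for \<open>w\<close> at position \<open>i\<close> once
    \<open>v\<close> is fixed: copied from \<open>v\<close> before \<open>k\<close>, one letter
    forbidden at \<open>k\<close> if \<open>v\<close> reaches beyond \<open>k\<close>, free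
    afterwards.\<close>
  define C where "C v i = (if i < k then {v ! i} else if i = k \<and> k < n then {1..b i} - {v ! i} else {1..b i})"
    for v and i :: nat
  define W where "W v = {w. length w = m \<and> (\<forall>i<m. w ! i \<in> C v i)}" for v
  let ?c = "(\<Prod>j\<in>{min (k + 1) n..<m}. b j) * (\<Prod>j\<in>{k} - {n, m}. a j - 1)"
  have Q: "Q = Sigma V W"
  proof (safe)
    fix v w assume vw: "(v, w) \<in> Q"
    then have *: "v \<in> labels" "w \<in> labels" "length v = n" "length w = m" "branch_at k v w"
      "\<forall>i<n. v ! i \<le> a i" "\<forall>i<m. w ! i \<le> b i"
      by (auto simp: Q_def label_pairs_def)
    with branch_at_iff_nth[OF *(3,4) k]
    show "v \<in> V" "w \<in> W v" by (auto simp: V_def W_def C_def labels_iff_nth)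
  next
    fix v w assume v: "v \<in> V" and w: "w \<in> W v"
    have mem: "w ! i \<in> C v i" if "i < m" for i using that w by (simp add: W_def)
    have le: "1 \<le> w ! i \<and> w ! i \<le> b i" if "i < m" for i
    proof -
      have "v ! i \<in> {1..b i}" if "i < k"
      proof -
        have "v ! i \<in> {1..a i}" using that v k by (simp add: V_def)
        then show ?thesis using that ab[of i] by simp
      qed
      then show ?thesis using mem[OF that] by (auto simp: C_def split: if_splits)
    qed
    have "w ! i = v ! i" if "i < k" for i
      using that mem[of i] k by (simp add: C_def)
    moreover have "w ! k \<noteq> v ! k" if "k < n" "k < m"
      using that mem[of k] by (simp add: C_def)
    ultimately show "(v, w) \<in> Q"
      using v w le branch_at_iff_nth[of v n w m k] k
      by (auto simp: V_def W_def Q_def label_pairs_def labels_iff_nth)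
  qed
  have finV: "finite V" and cardV: "card V = (\<Prod>i\<in>{0..<n}. a i)"
    unfolding V_def using card_lists_nth_mem[of n "\<lambda>i. {1..a i}"] by (auto simp: atLeast0LessThan)
  have W: "finite (W v)" "card (W v) = ?c" if v: "v \<in> V" for v
  proof -
    show "finite (W v)"
      unfolding W_def by (rule card_lists_nth_mem) (auto simp: C_def)
    have "card (W v) = (\<Prod>i<m. card (C v i))"
      unfolding W_def by (rule card_lists_nth_mem) (auto simp: C_def)
    \<comment> \<open>Copied letters leave a single choice and contribute a factor 1.\<close>
    also have "\<dots> = (\<Prod>i\<in>{k..<m}. card (C v i))"
      by (rule prod.mono_neutral_right) (auto simp: C_def)
    also have "\<dots> = ?c"
    proof (cases "k < n \<and> k < m")
      case True
      then have vk: "v ! k \<in> {1..b k}" using v ab[of k] by (auto simp: V_def)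
      have "(\<Prod>i\<in>{k..<m}. card (C v i)) = card (C v k) * (\<Prod>i\<in>{Suc k..<m}. card (C v i))"
        using True by (simp add: prod.atLeast_Suc_lessThan)
      \<comment> \<open>The forbidden letter \<open>v ! k\<close> lies within the range for
        \<open>w\<close> because \<open>a k = b k\<close>, so exactly one choice is lost.\<close>
      also have "card (C v k) = a k - 1"
        using vk True ab[of k] by (simp add: C_def card_Diff_singleton)
      also have "(\<Prod>i\<in>{Suc k..<m}. card (C v i)) = (\<Prod>i\<in>{Suc k..<m}. b i)"
        by (intro prod.cong) (auto simp: C_def)
      finally show ?thesis using True by (simp add: min_def)
    next
      case False
      \<comment> \<open>If \<open>k = n\<close>, the lower index \<open>min (k + 1) n\<close> is
        \<open>k\<close>; if \<open>k = m\<close>, both index ranges are empty.\<close>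
      then have "{k} - {n, m} = {}" "{min (k + 1) n..<m} = {k..<m}" using k by (auto simp: min_def)
      moreover have "(\<Prod>i\<in>{k..<m}. card (C v i)) = (\<Prod>i\<in>{k..<m}. b i)"
        using False by (intro prod.cong) (auto simp: C_def)
      ultimately show ?thesis by simp
    qed
    finally show "card (W v) = ?c" .
  qed
  show "finite Q"
    unfolding Q using finV W by auto
  have "card Q = (\<Sum>v\<in>V. card (W v))"
    unfolding Q using finV W by (intro card_SigmaI) auto
  also have "\<dots> = card V * ?c" using W by simp
  finally show "card Q = (\<Prod>i\<in>{0..<n}. a i) * (\<Prod>j\<in>{min (k + 1) n..<m}. b j) * (\<Prod>j\<in>{k} - {n, m}. a j - 1)"
    by (simp add: cardV mult.assoc)
qed

section \<open>The population in one realisation\<close>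

definition born_cells ::
    "('x \<Rightarrow> real) \<Rightarrow> ('x \<Rightarrow> nat) \<Rightarrow> (nat list \<Rightarrow> 'x) \<Rightarrow> real \<Rightarrow> nat list set" where
  "born_cells \<xi> \<kappa> z s = {v. occurs \<kappa> z v \<and> birth_time \<xi> z v \<le> s}"

definition divided_cells ::
    "('x \<Rightarrow> real) \<Rightarrow> ('x \<Rightarrow> nat) \<Rightarrow> (nat list \<Rightarrow> 'x) \<Rightarrow> real \<Rightarrow> nat list set" where
  "divided_cells \<xi> \<kappa> z s = {v. occurs \<kappa> z v \<and> division_time \<xi> z v \<le> s}"

text \<open>The model prescribes laws only along infinite lines, so a label is completed to one by
  repeating a filler letter \<open>j\<close>, which stays free in order to make two completions
  diverge.\<close>

definition line_through :: "nat list \<Rightarrow> nat \<Rightarrow> nat \<Rightarrow> nat list" where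
  "line_through v j n = take n v @ replicate (n - length v) j"

lemma line_of_descent_line_through:
  assumes "v \<in> labels" "1 \<le> j"
  shows "line_of_descent (line_through v j)"
proof -
  have "\<exists>i\<ge>1. line_through v j (Suc n) = line_through v j n @ [i]" for n
  proof (cases "n < length v")
    case True
    then show ?thesis
      using assms by (intro exI[of _ "v ! n"]) (auto simp: line_through_def take_Suc_conv_app_nth labels_iff_nth)
  next
    case False
    then have "Suc n - length v = Suc (n - length v)" by simp
    then show ?thesis
      using assms False
      by (intro exI[of _ j]) (simp add: line_through_def replicate_append_same)
  qed
  then show ?thesis by (simp add: line_of_descent_def line_through_def)
qed

lemma line_through_eq_take: "n \<le> length v \<Longrightarrow> line_through v j n = take n v"
  by (simp add: line_through_def)

lemma length_line_through [simp]: "length (line_through v j n) = n"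
  by (simp add: line_through_def)

lemma take_line_through: "i \<le> n \<Longrightarrow> take i (line_through v j n) = line_through v j i"
  by (cases "n \<le> length v") (auto simp: line_through_def min_def)

lemma line_through_Suc: "length v \<le> n \<Longrightarrow> line_through v j (Suc n) = line_through v j n @ [j]"
  by (simp add: line_through_def Suc_diff_le replicate_append_same)

lemma take_in_labels: "v \<in> labels \<Longrightarrow> take n v \<in> labels"
  by (auto simp: labels_def dest: in_set_takeD)

lemma occurs_snoc:
  "occurs \<kappa> z (v @ [j]) \<longleftrightarrow> occurs \<kappa> z v \<and> 1 \<le> j \<and> j \<le> \<kappa> (z v)"
  by (auto simp: occurs_def labels_def nth_append less_Suc_eq all_conj_distrib)

lemma birth_time_snoc: "birth_time \<xi> z (v @ [j]) = division_time \<xi> z v"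
proof -
  have "birth_time \<xi> z (v @ [j]) = (\<Sum>i<Suc (length v). \<xi> (z (take i v)))"
    unfolding birth_time_def by (intro sum.cong) auto
  then show ?thesis by (simp add: division_time_def lessThan_Suc_atMost)
qed

lemma division_time_eq_birth_time: "division_time \<xi> z v = birth_time \<xi> z v + \<xi> (z v)"
  by (simp add: division_time_def birth_time_def lessThan_Suc_atMost[symmetric])

lemma division_time_eq_lifetime_sum:
  "division_time \<xi> z v = lifetime_sum \<xi> (\<lambda>n. z (take n v)) (length v)"
  by (simp add: division_time_def lifetime_sum_def)

text \<open>Written as a function of a parameter sequence rather than of the whole field, so that
  equality in law along lines applies to it. The bounds on the letters of \<open>v\<close> express
  that the cell occurs.\<close>

definition division_weight ::
    "('x \<Rightarrow> real) \<Rightarrow> ('x \<Rightarrow> nat) \<Rightarrow> real \<Rightarrow> nat list \<Rightarrow> (nat \<Rightarrow> 'x) \<Rightarrow> ennreal" where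
  "division_weight \<xi> \<kappa> s v x =
     of_nat (\<kappa> (x (length v)) - 1) *
     indicator {x. (\<forall>i<length v. v ! i \<le> \<kappa> (x i)) \<and> lifetime_sum \<xi> x (length v) \<le> s} x"

lemma division_weight_line:
  assumes "v \<in> labels"
  shows "division_weight \<xi> \<kappa> s v (\<lambda>n. z (take n v)) =
    of_nat (\<kappa> (z v) - 1) * indicator (divided_cells \<xi> \<kappa> z s) v"
  using assms
  by (simp add: division_weight_def divided_cells_def occurs_def division_time_eq_lifetime_sum indicator_def)

text \<open>Hence the weight does not depend on how the label is completed to an infinite
  line.\<close>

lemma division_weight_cong:
  assumes "\<And>i. i \<le> length v \<Longrightarrow> x i = y i"
  shows "division_weight \<xi> \<kappa> s v x = division_weight \<xi> \<kappa> s v y"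
  using assms by (simp add: division_weight_def lifetime_sum_def indicator_def)

section \<open>Balance between births and divisions\<close>

context
  fixes \<xi> :: "'x \<Rightarrow> real" and \<kappa> :: "'x \<Rightarrow> nat" and z :: "nat list \<Rightarrow> 'x" and s :: real
  assumes nonneg: "\<And>v. v \<in> labels \<Longrightarrow> 0 \<le> \<xi> (z v)"
    and ge2: "\<And>v. v \<in> labels \<Longrightarrow> 2 \<le> \<kappa> (z v)"
    and s: "0 \<le> s"
begin

lemma divided_cells_subset_born: "divided_cells \<xi> \<kappa> z s \<subseteq> born_cells \<xi> \<kappa> z s"
  using nonneg
  by (force simp: divided_cells_def born_cells_def division_time_eq_birth_time occurs_def)

lemma born_cells_alive_or_divided:
  "born_cells \<xi> \<kappa> z s = alive_cells \<xi> \<kappa> z s \<union> divided_cells \<xi> \<kappa> z s"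
  "alive_cells \<xi> \<kappa> z s \<inter> divided_cells \<xi> \<kappa> z s = {}"
  using divided_cells_subset_born
  by (auto simp: divided_cells_def born_cells_def alive_cells_def)

text \<open>A child is born exactly when its mother divides, so every born cell other than the root
  comes from a divided cell; \<open>0 \<le> s\<close> accounts for the root.\<close>

lemma born_cells_eq_children:
  "born_cells \<xi> \<kappa> z s =
     insert [] ((\<lambda>(v, j). v @ [j]) ` Sigma (divided_cells \<xi> \<kappa> z s) (\<lambda>v. {1..\<kappa> (z v)}))"
proof (intro set_eqI iffI)
  fix u assume u: "u \<in> born_cells \<xi> \<kappa> z s"
  show "u \<in> insert [] ((\<lambda>(v, j). v @ [j]) ` Sigma (divided_cells \<xi> \<kappa> z s) (\<lambda>v. {1..\<kappa> (z v)}))"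
  proof (cases u rule: rev_exhaust)
    case (snoc v j)
    then have "(v, j) \<in> Sigma (divided_cells \<xi> \<kappa> z s) (\<lambda>v. {1..\<kappa> (z v)})"
      using u by (auto simp: born_cells_def divided_cells_def occurs_snoc birth_time_snoc)
    then show ?thesis unfolding snoc by force
  qed simp
next
  fix u assume "u \<in> insert [] ((\<lambda>(v, j). v @ [j]) ` Sigma (divided_cells \<xi> \<kappa> z s) (\<lambda>v. {1..\<kappa> (z v)}))"
  moreover have "[] \<in> born_cells \<xi> \<kappa> z s"
    using s by (simp add: born_cells_def occurs_def birth_time_def labels_def)
  ultimately show "u \<in> born_cells \<xi> \<kappa> z s"
    by (auto simp: born_cells_def divided_cells_def occurs_snoc birth_time_snoc)
qed

text \<open>The born cells are counted twice: as alive plus divided cells, and as the root plus the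
  children of the divided cells. Finiteness permits the subtraction, and
  \<open>\<kappa> \<ge> 2\<close> makes the truncated difference \<open>\<kappa> - 1\<close>
  exact.\<close>

lemma card_alive_cells:
  assumes fin: "finite (born_cells \<xi> \<kappa> z s)"
  shows "card (alive_cells \<xi> \<kappa> z s) = 1 + (\<Sum>v\<in>divided_cells \<xi> \<kappa> z s. \<kappa> (z v) - 1)"
proof -
  let ?D = "divided_cells \<xi> \<kappa> z s"
  let ?C = "Sigma ?D (\<lambda>v. {1..\<kappa> (z v)})"
  have finD: "finite ?D" and finA: "finite (alive_cells \<xi> \<kappa> z s)"
    using fin by (auto simp: born_cells_alive_or_divided(1))
  have inj: "inj_on (\<lambda>(v, j). v @ [j]) ?C" by (auto simp: inj_on_def)
  have "card (born_cells \<xi> \<kappa> z s) = Suc (card ?C)"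
    unfolding born_cells_eq_children using finD
    by (subst card_insert_disjoint) (auto simp: card_image[OF inj] simp del: One_nat_def card_SigmaI)
  also have "card ?C = (\<Sum>v\<in>?D. \<kappa> (z v))" using finD by simp
  also have "\<dots> = (\<Sum>v\<in>?D. (\<kappa> (z v) - 1) + 1)"
  proof (rule sum.cong)
    fix v assume "v \<in> ?D"
    then have "2 \<le> \<kappa> (z v)" using ge2 by (auto simp: divided_cells_def occurs_def)
    then show "\<kappa> (z v) = (\<kappa> (z v) - 1) + 1" by simp
  qed simp
  also have "\<dots> = (\<Sum>v\<in>?D. \<kappa> (z v) - 1) + card ?D" by (subst sum.distrib) simp
  also have "card (born_cells \<xi> \<kappa> z s) = card (alive_cells \<xi> \<kappa> z s) + card ?D"
    unfolding born_cells_alive_or_divided(1)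
    by (rule card_Un_disjoint[OF finA finD born_cells_alive_or_divided(2)])
  finally show ?thesis by simp
qed

text \<open>Every cell born by time \<open>s\<close> is an ancestor of a cell alive at time \<open>s\<close>, found by following
  first-born descendants: only countably many lines enter, although there are uncountably many.\<close>

lemma finite_born_cells:
  assumes fin: "finite (alive_cells \<xi> \<kappa> z s)"
    and noexp: "\<And>v. v \<in> labels \<Longrightarrow> \<exists>n. s < lifetime_sum \<xi> (\<lambda>i. z (line_through v 1 i)) n"
  shows "finite (born_cells \<xi> \<kappa> z s)"
proof -
  have descendant: "\<exists>n\<ge>length v. line_through v 1 n \<in> alive_cells \<xi> \<kappa> z s"
    if v: "v \<in> born_cells \<xi> \<kappa> z s" for v
  proof (rule ccontr)
    assume neg: "\<not> (\<exists>n\<ge>length v. line_through v 1 n \<in> alive_cells \<xi> \<kappa> z s)"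
    \<comment> \<open>If no first-born descendant is alive at time \<open>s\<close>, each one that
      is born has divided, so its own first child is born too. This never ends.\<close>
    have born: "line_through v 1 n \<in> born_cells \<xi> \<kappa> z s" if "length v \<le> n" for n
      using that
    proof (induction n rule: dec_induct)
      case base
      then show ?case using v by (simp add: line_through_def)
    next
      case (step n)
      then have "line_through v 1 n \<in> divided_cells \<xi> \<kappa> z s"
        using neg born_cells_alive_or_divided(1) by blast
      moreover from this have "2 \<le> \<kappa> (z (line_through v 1 n))"
        using ge2 by (auto simp: divided_cells_def occurs_def)
      ultimately show ?case
        using step by (simp add: line_through_Suc born_cells_def divided_cells_def occurs_snoc birth_time_snoc)
    qed
    have lab: "v \<in> labels" using v by (simp add: born_cells_def occurs_def)
    have nn: "0 \<le> \<xi> (z (line_through v 1 i))" for i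
      using lab by (intro nonneg) (auto simp: labels_def line_through_def dest: in_set_takeD)
    obtain n where n: "s < lifetime_sum \<xi> (\<lambda>i. z (line_through v 1 i)) n"
      using noexp lab by blast
    \<comment> \<open>The generation lies beyond \<open>length v\<close>, so the cell is born by
      \<open>s\<close>, and beyond \<open>n\<close>, so its birth time includes the lifetimes whose
      sum already exceeds \<open>s\<close>.\<close>
    let ?n = "Suc (max n (length v))"
    have "lifetime_sum \<xi> (\<lambda>i. z (line_through v 1 i)) n \<le> (\<Sum>i<?n. \<xi> (z (line_through v 1 i)))"
      unfolding lifetime_sum_def by (intro sum_mono2) (auto intro: nn simp del: One_nat_def)
    also have "\<dots> = birth_time \<xi> z (line_through v 1 ?n)"
      unfolding birth_time_def by (intro sum.cong) (auto simp: take_line_through)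
    also have "\<dots> \<le> s" using born[of ?n] by (simp add: born_cells_def)
    finally show False using n by simp
  qed
  have "v \<in> (\<Union>u\<in>alive_cells \<xi> \<kappa> z s. (\<lambda>i. take i u) ` {..length u})" if v: "v \<in> born_cells \<xi> \<kappa> z s" for v
  proof -
    obtain n where n: "length v \<le> n" "line_through v 1 n \<in> alive_cells \<xi> \<kappa> z s"
      using descendant[OF v] by blast
    have "v = take (length v) (line_through v 1 n)"
      using n(1) by (simp add: take_line_through line_through_def)
    then show ?thesis using n by (intro UN_I[OF n(2)]) auto
  qed
  then have "born_cells \<xi> \<kappa> z s \<subseteq> (\<Union>u\<in>alive_cells \<xi> \<kappa> z s. (\<lambda>i. take i u) ` {..length u})" by blast
  then show ?thesis by (rule finite_subset) (use fin in auto)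
qed

text \<open>The sum now runs over all labels, an index set that does not depend on the realisation;
  this is what allows exchanging it with expectations.\<close>

lemma num_alive_cells_eq:
  assumes "finite (born_cells \<xi> \<kappa> z s)"
  shows "emeasure (count_space UNIV) (alive_cells \<xi> \<kappa> z s) =
    1 + (\<integral>\<^sup>+ v. division_weight \<xi> \<kappa> s v (\<lambda>n. z (take n v)) \<partial>count_space labels)"
proof -
  let ?D = "divided_cells \<xi> \<kappa> z s"
  have finD: "finite ?D" and finA: "finite (alive_cells \<xi> \<kappa> z s)"
    using assms by (auto simp: born_cells_alive_or_divided(1))
  have sub: "?D \<subseteq> labels" by (auto simp: divided_cells_def occurs_def)
  have "(\<integral>\<^sup>+ v. division_weight \<xi> \<kappa> s v (\<lambda>n. z (take n v)) \<partial>count_space labels) =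
      (\<integral>\<^sup>+ v. of_nat (\<kappa> (z v) - 1) * indicator ?D v \<partial>count_space labels)"
    by (intro nn_integral_cong) (simp add: division_weight_line)
  also have "\<dots> = (\<Sum>v\<in>?D. of_nat (\<kappa> (z v) - 1))"
    using finD sub by (subst nn_integral_indicator_finite) (auto intro!: sum.cong)
  finally show ?thesis
    using finA by (simp add: emeasure_count_space_finite card_alive_cells[OF assms])
qed

end

section \<open>Sums over labels and over pairs of labels\<close>

lemma born_cells_mono: "s \<le> s' \<Longrightarrow> born_cells \<xi> \<kappa> z s \<subseteq> born_cells \<xi> \<kappa> z s'"
  by (auto simp: born_cells_def)

lemma countable_labels: "countable labels"
  by simp

lemma borel_measurable_nn_integral_count_space:
  assumes "countable I" and f: "\<And>i. i \<in> I \<Longrightarrow> f i \<in> borel_measurable M"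
  shows "(\<lambda>x. \<integral>\<^sup>+ i. f i x \<partial>count_space I) \<in> borel_measurable M"
proof (rule sigma_finite_measure.borel_measurable_nn_integral)
  show "sigma_finite_measure (count_space I)"
    using assms(1) by (rule sigma_finite_measure_count_space_countable)
  show "(\<lambda>(x, i). f i x) \<in> borel_measurable (M \<Otimes>\<^sub>M count_space I)"
    using measurable_compose_countable'[OF _ _ assms(1), where f = "\<lambda>i p. f i (fst p)" and g = snd] f
    by (simp add: case_prod_beta)
qed

lemma nn_integral_count_space_times:
  assumes "countable A" "countable B"
  shows "(\<integral>\<^sup>+ v. f v \<partial>count_space A) * (\<integral>\<^sup>+ w. g w \<partial>count_space B) =
    (\<integral>\<^sup>+ p. f (fst p) * g (snd p) \<partial>count_space (A \<times> B))"
proof -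
  interpret B: sigma_finite_measure "count_space B"
    using assms(2) by (rule sigma_finite_measure_count_space_countable)
  have "(\<integral>\<^sup>+ v. f v \<partial>count_space A) * (\<integral>\<^sup>+ w. g w \<partial>count_space B) =
      (\<integral>\<^sup>+ v. \<integral>\<^sup>+ w. f v * g w \<partial>count_space B \<partial>count_space A)"
    by (simp add: nn_integral_cmult nn_integral_multc)
  also have "\<dots> = (\<integral>\<^sup>+ p. f (fst p) * g (snd p) \<partial>(count_space A \<Otimes>\<^sub>M count_space B))"
    by (subst B.nn_integral_fst[symmetric]) (auto simp: pair_measure_countable[OF assms])
  finally show ?thesis by (simp add: pair_measure_countable[OF assms])
qed

text \<open>The sets \<open>label_pairs n m k\<close> partition the pairs of labels, since lengths
  and branching generation are determined by the pair; \<open>k\<close> cannot exceed either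
  length.\<close>

lemma nn_integral_label_pairs:
  "(\<integral>\<^sup>+ p. G p \<partial>count_space (labels \<times> labels)) =
     (\<Sum>n m. \<Sum>k = 0..min n m. \<integral>\<^sup>+ p. G p \<partial>count_space (label_pairs n m k))"
proof -
  have split: "(\<Sum>n m. \<Sum>k = 0..min n m. G p * indicator (label_pairs n m k) p) = G p"
    if p: "p \<in> labels \<times> labels" for p
  proof -
    obtain v w where vw: "p = (v, w)" "v \<in> labels" "w \<in> labels" using p by auto
    obtain k where k: "\<And>j. branch_at j v w \<longleftrightarrow> j = k" using ex1_branch_at[of v w] by metis
    have "branch_at k v w" using k by simp
    then have kle: "k \<le> min (length v) (length w)" by (auto simp: branch_at_def)
    \<comment> \<open>In this product form the three sums collapse one after the other, each to a
      single term.\<close>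
    have ind: "(indicator (label_pairs n m j) p :: ennreal) =
        indicator {length v} n * (indicator {length w} m * (if j = k then 1 else 0))" for n m j
      using vw k by (auto simp: label_pairs_def indicator_def)
    have inner: "(\<Sum>j = 0..min n m. G p * indicator (label_pairs n m j) p) =
        G p * indicator {length v} n * indicator {length w} m" for n m
    proof (cases "n = length v \<and> m = length w")
      case True
      then show ?thesis using kle
        by (simp add: ind if_distrib[where f = "\<lambda>x. G p * x"] cong: if_cong)
    next
      case False
      then show ?thesis by (auto simp: ind)
    qed
    have single: "suminf (indicator {l}) = (1 :: ennreal)" for l :: nat
      by (subst suminf_finite[of "{l}"]) auto
    show ?thesis
      unfolding inner by (simp add: single)
  qed
  have eq: "(\<integral>\<^sup>+ p. G p \<partial>count_space (label_pairs n m k)) =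
      (\<integral>\<^sup>+ p. G p * indicator (label_pairs n m k) p \<partial>count_space (labels \<times> labels))" for n m k
  proof -
    have sub: "label_pairs n m k \<subseteq> labels \<times> labels" by (auto simp: label_pairs_def)
    then have "indicator (label_pairs n m k) p * indicator (labels \<times> labels) p =
        (indicator (label_pairs n m k) p :: ennreal)" for p
      by (auto simp: indicator_def)
    then show ?thesis
      by (simp add: nn_integral_count_space_indicator mult.assoc)
  qed
  have "(\<integral>\<^sup>+ p. G p \<partial>count_space (labels \<times> labels)) =
      (\<integral>\<^sup>+ p. (\<Sum>n m. \<Sum>k = 0..min n m. G p * indicator (label_pairs n m k) p) \<partial>count_space (labels \<times> labels))"
    by (intro nn_integral_cong split[symmetric]) simp
  also have "\<dots> = (\<Sum>n m. \<Sum>k = 0..min n m. \<integral>\<^sup>+ p. G p \<partial>count_space (label_pairs n m k))"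
    unfolding eq by (simp only: nn_integral_suminf nn_integral_sum borel_measurable_count_space)
  finally show ?thesis .
qed

section \<open>Infinite lines through a pair of labels\<close>

lemma line_of_descent_in_labels:
  assumes "line_of_descent v"
  shows "v n \<in> labels"
proof (induction n)
  case 0
  then show ?case using assms by (simp add: line_of_descent_def labels_def)
next
  case (Suc n)
  obtain j where "1 \<le> j" "v (Suc n) = v n @ [j]" using assms by (auto simp: line_of_descent_def)
  then show ?case using Suc by (auto simp: labels_def)
qed

lemma coincide_line_through:
  assumes b: "branch_at k v w"
  obtains i j where "1 \<le> i" "1 \<le> j" "coincide_exactly_up_to k (line_through v i) (line_through w j)"
proof -
  \<comment> \<open>The filler letters force a separation right after generation \<open>k\<close>: a
    label that ends there continues with a letter other than the next one of its partner. If both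
    end there, the fillers are 2 and 1. The successor keeps them positive.\<close>
  define i where "i = Suc (if k < length w then w ! k else 1)"
  define j where "j = Suc (if k < length v then v ! k else 0)"
  have k: "k \<le> length v" "k \<le> length w" "take k v = take k w"
    and ne: "k < length v \<Longrightarrow> k < length w \<Longrightarrow> v ! k \<noteq> w ! k"
    using b by (auto simp: branch_at_def)
  have same: "line_through v i l = line_through w j l" if "l \<le> k" for l
  proof -
    have "take l (take k v) = take l (take k w)" by (simp add: k(3))
    then show ?thesis using that k(1,2) by (simp add: line_through_eq_take min_absorb1)
  qed
  have last: "last (line_through u l (Suc k)) = (if k < length u then u ! k else l)" if "k \<le> length u" for u :: "nat list" and l
    using that by (auto simp: line_through_eq_take take_Suc_conv_app_nth line_through_Suc)
  have "last (line_through v i (Suc k)) \<noteq> last (line_through w j (Suc k))"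
    using ne k(1,2) by (simp add: last i_def j_def)
  then have "line_through v i (Suc k) \<noteq> line_through w j (Suc k)" by metis
  with same have "coincide_exactly_up_to k (line_through v i) (line_through w j)"
    by (simp add: coincide_exactly_up_to_def)
  then show ?thesis by (rule that[rotated 2]) (simp_all add: i_def j_def)
qed

section \<open>Expectations\<close>

context branching_model
begin

lemmas [measurable] = measurable_lifetime measurable_offspring

lemma measurable_field_seq:
  assumes "\<And>n. v n \<in> labels"
  shows "(\<lambda>\<omega> n. Z (v n) \<omega>) \<in> measurable M (seq_space E)"
  using measurable_field[OF assms] by (intro measurable_PiM_single') (auto dest: measurable_space)

lemma measurable_process_seq: "(\<lambda>\<omega> n. X n \<omega>) \<in> measurable P (seq_space E)"
  using measurable_process by (intro measurable_PiM_single') (auto dest: measurable_space)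

lemma measurable_division_weight [measurable]:
  "division_weight \<xi> \<kappa> s v \<in> borel_measurable (seq_space E)"
  unfolding division_weight_def lifetime_sum_def indicator_def mem_Collect_eq
  by measurable

lemma measurable_division_weight_field:
  assumes "v \<in> labels"
  shows "(\<lambda>\<omega>. division_weight \<xi> \<kappa> s v (\<lambda>n. Z (take n v) \<omega>)) \<in> borel_measurable M"
  using measurable_field_seq[of "\<lambda>n. take n v"] take_in_labels[OF assms] by measurable

text \<open>Being alive depends on a label and its ancestors only, and there are countably many
  labels to sum over.\<close>

lemma num_alive_measurable: "num_alive \<xi> \<kappa> Z s \<in> borel_measurable M"
proof -
  have eq: "num_alive \<xi> \<kappa> Z s =
      (\<lambda>\<omega>. \<integral>\<^sup>+ v. indicator (alive_cells \<xi> \<kappa> (\<lambda>v. Z v \<omega>) s) v \<partial>count_space labels)"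
  proof
    fix \<omega>
    have "indicator (alive_cells \<xi> \<kappa> (\<lambda>v. Z v \<omega>) s) v =
        (indicator (alive_cells \<xi> \<kappa> (\<lambda>v. Z v \<omega>) s) v * indicator labels v :: ennreal)" for v
      by (auto simp: alive_cells_def occurs_def indicator_def)
    then show "num_alive \<xi> \<kappa> Z s \<omega> =
        (\<integral>\<^sup>+ v. indicator (alive_cells \<xi> \<kappa> (\<lambda>v. Z v \<omega>) s) v \<partial>count_space labels)"
      by (simp add: num_alive_def nn_integral_count_space_indicator flip: nn_integral_indicator)
  qed
  have "(\<lambda>\<omega>. indicator (alive_cells \<xi> \<kappa> (\<lambda>v. Z v \<omega>) s) v) \<in> borel_measurable M"
    if v: "v \<in> labels" for v
  proof -
    note [measurable] = measurable_field[OF take_in_labels[OF v]]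
    show ?thesis
      unfolding alive_cells_def occurs_def birth_time_def division_time_def indicator_def mem_Collect_eq
      by measurable
  qed
  then show ?thesis
    unfolding eq by (rule borel_measurable_nn_integral_count_space[OF countable_labels])
qed

text \<open>Non-explosion is an event about one parameter sequence, so it passes from
  \<open>X\<close> to each fixed line through equality in law; countably many lines give a common
  null set.\<close>

lemma AE_lines_through_no_explosion:
  assumes "no_explosion_by P \<xi> X s"
  shows "AE \<omega> in M. \<forall>v\<in>labels. \<exists>n. s < lifetime_sum \<xi> (\<lambda>i. Z (line_through v 1 i) \<omega>) n"
  unfolding AE_ball_countable[OF countable_labels]
proof
  fix v assume "v \<in> labels"
  then have line: "line_of_descent (line_through v 1)" by (simp add: line_of_descent_line_through)
  have meas: "{x \<in> space (seq_space E). \<exists>n. s < lifetime_sum \<xi> x n} \<in> sets (seq_space E)"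
    unfolding lifetime_sum_def by measurable
  have "AE x in distr P (seq_space E) (\<lambda>\<omega> n. X n \<omega>). \<exists>n. s < lifetime_sum \<xi> x n"
    using assms unfolding no_explosion_by_def
    by (subst AE_distr_iff[OF measurable_process_seq meas])
  then show "AE \<omega> in M. \<exists>n. s < lifetime_sum \<xi> (\<lambda>i. Z (line_through v 1 i) \<omega>) n"
    unfolding law_of_line[OF line, symmetric]
    by (subst (asm) AE_distr_iff[OF measurable_field_seq[OF line_of_descent_in_labels[OF line]] meas])
qed

text \<open>Finiteness is known at the later time \<open>u\<close> only. It bounds the cells born by
  \<open>u\<close>, hence those born by \<open>s\<close>, so the same hypotheses serve both
  times.\<close>

lemma AE_num_alive_eq:
  assumes "0 \<le> s" "s \<le> u" "no_explosion_by P \<xi> X u" "(\<integral>\<^sup>+ \<omega>. num_alive \<xi> \<kappa> Z u \<omega> \<partial>M) < \<infinity>"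
  shows "AE \<omega> in M. num_alive \<xi> \<kappa> Z s \<omega> =
    1 + (\<integral>\<^sup>+ v. division_weight \<xi> \<kappa> s v (\<lambda>n. Z (take n v) \<omega>) \<partial>count_space labels)"
  using AE_lines_through_no_explosion[OF assms(3)]
    nn_integral_PInf_AE[OF num_alive_measurable assms(4)[THEN less_imp_neq]]
    AE_space
proof eventually_elim
  case (elim \<omega>)
  let ?z = "\<lambda>v. Z v \<omega>"
  have E: "?z v \<in> space E" if "v \<in> labels" for v
    using measurable_field[OF that] elim(3) by (rule measurable_space)
  have "finite (alive_cells \<xi> \<kappa> ?z u)"
    using elim(2) by (cases "finite (alive_cells \<xi> \<kappa> ?z u)") (auto simp: num_alive_def)
  then have "finite (born_cells \<xi> \<kappa> ?z u)"
    using elim(1) assms(1,2) E lifetime_nonneg offspring_ge_2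
    by (intro finite_born_cells) auto
  then have "finite (born_cells \<xi> \<kappa> ?z s)"
    using born_cells_mono[OF assms(2)] by (rule rev_finite_subset)
  then show ?case
    unfolding num_alive_def using assms(1) E lifetime_nonneg offspring_ge_2
    by (intro num_alive_cells_eq) auto
qed

end

section \<open>Expectations over pairs of divided cells\<close>

context pairwise_stationary_model
begin

lemma measurable_copy_seq: "(\<lambda>\<omega> n. Y k n \<omega>) \<in> measurable P (seq_space E)"
  using measurable_copy by (intro measurable_PiM_single') (auto dest: measurable_space)

text \<open>The labels are completed to lines separating exactly after generation \<open>k\<close>.
  The weights do not see the completion, so the law of that pair of lines gives the value.\<close>

lemma nn_integral_division_weight_pair:
  assumes p: "v \<in> labels" "w \<in> labels" "branch_at k v w"
  shows "(\<integral>\<^sup>+ \<omega>. division_weight \<xi> \<kappa> s v (\<lambda>n. Z (take n v) \<omega>) *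
        division_weight \<xi> \<kappa> u w (\<lambda>n. Z (take n w) \<omega>) \<partial>M) =
    (\<integral>\<^sup>+ \<omega>. division_weight \<xi> \<kappa> s v (\<lambda>n. X n \<omega>) * division_weight \<xi> \<kappa> u w (\<lambda>n. Y k n \<omega>) \<partial>P)"
proof -
  obtain i j where ij: "1 \<le> i" "1 \<le> j"
    and co: "coincide_exactly_up_to k (line_through v i) (line_through w j)"
    using p(3) by (rule coincide_line_through)
  have lv: "line_of_descent (line_through v i)" and lw: "line_of_descent (line_through w j)"
    using p ij by (auto simp: line_of_descent_line_through)
  note [measurable] = measurable_field_seq[OF line_of_descent_in_labels[OF lv]]
    measurable_field_seq[OF line_of_descent_in_labels[OF lw]] measurable_process_seq measurable_copy_seq
  define F where "F = (\<lambda>(x, y). division_weight \<xi> \<kappa> s v x * division_weight \<xi> \<kappa> u w y)"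
  have F [measurable]: "F \<in> borel_measurable (seq_space E \<Otimes>\<^sub>M seq_space E)"
    unfolding F_def by measurable
  have "division_weight \<xi> \<kappa> s v (\<lambda>n. Z (take n v) \<omega>) * division_weight \<xi> \<kappa> u w (\<lambda>n. Z (take n w) \<omega>) =
      F (\<lambda>n. Z (line_through v i n) \<omega>, \<lambda>n. Z (line_through w j n) \<omega>)" for \<omega>
    unfolding F_def prod.case
    using division_weight_cong[of v "\<lambda>n. Z (take n v) \<omega>" "\<lambda>n. Z (line_through v i n) \<omega>"]
      division_weight_cong[of w "\<lambda>n. Z (take n w) \<omega>" "\<lambda>n. Z (line_through w j n) \<omega>"]
    by (simp add: line_through_eq_take)
  then have "(\<integral>\<^sup>+ \<omega>. division_weight \<xi> \<kappa> s v (\<lambda>n. Z (take n v) \<omega>) *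
        division_weight \<xi> \<kappa> u w (\<lambda>n. Z (take n w) \<omega>) \<partial>M) =
      (\<integral>\<^sup>+ q. F q \<partial>distr M (seq_space E \<Otimes>\<^sub>M seq_space E)
        (\<lambda>\<omega>. (\<lambda>n. Z (line_through v i n) \<omega>, \<lambda>n. Z (line_through w j n) \<omega>)))"
    by (subst nn_integral_distr) auto
  also have "\<dots> = (\<integral>\<^sup>+ \<omega>. F (\<lambda>n. X n \<omega>, \<lambda>n. Y k n \<omega>) \<partial>P)"
    unfolding law_of_pair[OF lv lw co] by (subst nn_integral_distr) auto
  finally show ?thesis by (simp add: F_def)
qed

text \<open>By Tonelli the pairs can be counted for fixed \<open>X\<close> and \<open>Y k\<close>.
  The count supplies the first three products of the weight, the two division weights its last two
  factors.\<close>

lemma nn_integral_label_pairs_division_weight: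
  assumes k: "k \<le> n" "k \<le> m"
  shows "(\<integral>\<^sup>+ p. (\<integral>\<^sup>+ \<omega>. division_weight \<xi> \<kappa> s (fst p) (\<lambda>n. Z (take n (fst p)) \<omega>) *
        division_weight \<xi> \<kappa> u (snd p) (\<lambda>n. Z (take n (snd p)) \<omega>) \<partial>M) \<partial>count_space (label_pairs n m k)) =
    (\<integral>\<^sup>+ \<omega>. of_nat (pair_weight \<kappa> (\<lambda>j. X j \<omega>) (\<lambda>j. Y k j \<omega>) (Suc n) (Suc m) k) *
      indicator {\<omega>. lifetime_sum \<xi> (\<lambda>j. X j \<omega>) n \<le> s \<and> lifetime_sum \<xi> (\<lambda>j. Y k j \<omega>) m \<le> u} \<omega> \<partial>P)"
    (is "?lhs = ?rhs")
proof -
  note [measurable] = measurable_process_seq measurable_copy_seq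
  have "?lhs = (\<integral>\<^sup>+ p. (\<integral>\<^sup>+ \<omega>. division_weight \<xi> \<kappa> s (fst p) (\<lambda>n. X n \<omega>) *
      division_weight \<xi> \<kappa> u (snd p) (\<lambda>n. Y k n \<omega>) \<partial>P) \<partial>count_space (label_pairs n m k))"
    by (intro nn_integral_cong nn_integral_division_weight_pair) (auto simp: label_pairs_def)
  also have "\<dots> = (\<integral>\<^sup>+ \<omega>. (\<integral>\<^sup>+ p. division_weight \<xi> \<kappa> s (fst p) (\<lambda>n. X n \<omega>) *
      division_weight \<xi> \<kappa> u (snd p) (\<lambda>n. Y k n \<omega>) \<partial>count_space (label_pairs n m k)) \<partial>P)"
    by (rule nn_integral_count_space_nn_integral[symmetric]) auto
  also have "\<dots> = ?rhs"
  \<comment> \<open>Almost sure agreement up to generation \<open>k\<close> is the compatibility of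
    letter bounds that the count of pairs requires.\<close>
  proof (rule nn_integral_cong_AE, use copy_coincides[of k] in eventually_elim)
    case (elim \<omega>)
    let ?x = "\<lambda>n. X n \<omega>" and ?y = "\<lambda>n. Y k n \<omega>"
    let ?B = "{(v, w) \<in> label_pairs n m k. (\<forall>i<n. v ! i \<le> \<kappa> (?x i)) \<and> (\<forall>i<m. w ! i \<le> \<kappa> (?y i))}"
    let ?c = "(of_nat (\<kappa> (?x n) - 1) * of_nat (\<kappa> (?y m) - 1) *
      indicator {\<omega>. lifetime_sum \<xi> (\<lambda>j. X j \<omega>) n \<le> s \<and> lifetime_sum \<xi> (\<lambda>j. Y k j \<omega>) m \<le> u} \<omega> :: ennreal)"
    have eq: "\<kappa> (?x i) = \<kappa> (?y i)" if "i \<le> k" for i using elim that by simp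
    have fin: "finite ?B"
      by (rule card_bounded_label_pairs(1)[OF k]) (simp add: eq)
    have card: "card ?B = (\<Prod>i\<in>{0..<n}. \<kappa> (?x i)) * (\<Prod>j\<in>{min (k + 1) n..<m}. \<kappa> (?y j)) *
        (\<Prod>j\<in>{k} - {n, m}. \<kappa> (?x j) - 1)"
      by (rule card_bounded_label_pairs(2)[OF k]) (simp add: eq)
    have "(\<integral>\<^sup>+ p. division_weight \<xi> \<kappa> s (fst p) ?x * division_weight \<xi> \<kappa> u (snd p) ?y
        \<partial>count_space (label_pairs n m k)) = (\<integral>\<^sup>+ p. ?c * indicator ?B p \<partial>count_space (label_pairs n m k))"
    proof (rule nn_integral_cong)
      fix p assume "p \<in> space (count_space (label_pairs n m k))"
      then obtain v w where "p = (v, w)" "(v, w) \<in> label_pairs n m k" "length v = n" "length w = m"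
        by (auto simp: label_pairs_def)
      then show "division_weight \<xi> \<kappa> s (fst p) ?x * division_weight \<xi> \<kappa> u (snd p) ?y = ?c * indicator ?B p"
        by (auto simp: division_weight_def indicator_def)
    qed
    also have "\<dots> = ?c * emeasure (count_space (label_pairs n m k)) ?B"
      by (subst nn_integral_cmult_indicator) auto
    also have "emeasure (count_space (label_pairs n m k)) ?B = of_nat (card ?B)"
      using fin by (subst emeasure_count_space_finite) auto
    \<comment> \<open>A label of length \<open>n\<close> matches index \<open>Suc n\<close>, since
      the weight refers to the cell itself by \<open>n - 1\<close>.\<close>
    also have "?c * of_nat (card ?B) = of_nat (pair_weight \<kappa> ?x ?y (Suc n) (Suc m) k) *
      indicator {\<omega>. lifetime_sum \<xi> (\<lambda>j. X j \<omega>) n \<le> s \<and> lifetime_sum \<xi> (\<lambda>j. Y k j \<omega>) m \<le> u} \<omega>"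
      unfolding card pair_weight_def by (simp add: mult_ac)
    finally show ?case .
  qed
  finally show ?thesis .
qed

end

section \<open>The second moment formula\<close>

theorem proposition3p2:
  fixes E :: "'x measure" and \<xi> :: "'x \<Rightarrow> real" and \<kappa> :: "'x \<Rightarrow> nat"
    and M :: "'w measure" and Z :: "nat list \<Rightarrow> 'w \<Rightarrow> 'x"
    and P :: "'p measure" and X :: "nat \<Rightarrow> 'p \<Rightarrow> 'x"
    and Y :: "nat \<Rightarrow> nat \<Rightarrow> 'p \<Rightarrow> 'x"
    and t \<tau> :: real
  defines "N \<equiv> num_alive \<xi> \<kappa> Z"
    and "S \<equiv> \<lambda>n \<omega>. lifetime_sum \<xi> (\<lambda>j. X j \<omega>) n"
    and "S' \<equiv> \<lambda>k n \<omega>. lifetime_sum \<xi> (\<lambda>j. Y k j \<omega>) n"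
    and "A \<equiv> \<lambda>n m k \<omega>. pair_weight \<kappa> (\<lambda>j. X j \<omega>) (\<lambda>j. Y k j \<omega>) n m k"
  assumes "pairwise_stationary_model E \<xi> \<kappa> M Z P X Y"
    and "t > 0" and "\<tau> \<ge> 0"
    and "no_explosion_by P \<xi> X (t + \<tau>)"
    and "(\<integral>\<^sup>+ \<omega>. N (t + \<tau>) \<omega> \<partial>M) < \<infinity>"
  shows "(\<integral>\<^sup>+ \<omega>. N t \<omega> * N (t + \<tau>) \<omega> \<partial>M) =
    (\<integral>\<^sup>+ \<omega>. N t \<omega> \<partial>M) + (\<integral>\<^sup>+ \<omega>. N (t + \<tau>) \<omega> \<partial>M) - 1 +
    (\<Sum>n'. \<Sum>m'. let n = Suc n'; m = Suc m' in
       \<Sum>k = 0..min n m - 1.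
         \<integral>\<^sup>+ \<omega>. of_nat (A n m k \<omega>) *
               indicator {\<omega>. S (n - 1) \<omega> \<le> t \<and> S' k (m - 1) \<omega> \<le> t + \<tau>} \<omega> \<partial>P)"
proof -
  interpret pairwise_stationary_model E \<xi> \<kappa> M Z P X Y by fact
  define f where "f s v \<omega> = division_weight \<xi> \<kappa> s v (\<lambda>n. Z (take n v) \<omega>)" for s v \<omega>
  define a where "a s \<omega> = (\<integral>\<^sup>+ v. f s v \<omega> \<partial>count_space labels)" for s \<omega>
  let ?u = "t + \<tau>"
  have f: "f s v \<in> borel_measurable M" if "v \<in> labels" for s v
    unfolding f_def using that by (rule measurable_division_weight_field)
  have [measurable]: "a s \<in> borel_measurable M" for s
    unfolding a_def using f by (rule borel_measurable_nn_integral_count_space[OF countable_labels])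
  have N: "AE \<omega> in M. N s \<omega> = 1 + a s \<omega>" if "s \<in> {t, ?u}" for s
    unfolding N_def a_def f_def using assms(5-) that by (intro AE_num_alive_eq[of _ ?u]) (auto simp: N_def)
  have EN: "(\<integral>\<^sup>+ \<omega>. N s \<omega> \<partial>M) = 1 + (\<integral>\<^sup>+ \<omega>. a s \<omega> \<partial>M)" if "s \<in> {t, ?u}" for s
    using nn_integral_cong_AE[OF N[OF that]] by (simp add: nn_integral_add tree.emeasure_space_1)
  have "(\<integral>\<^sup>+ \<omega>. a t \<omega> * a ?u \<omega> \<partial>M) =
      (\<integral>\<^sup>+ \<omega>. \<integral>\<^sup>+ p. f t (fst p) \<omega> * f ?u (snd p) \<omega> \<partial>count_space (labels \<times> labels) \<partial>M)"
    unfolding a_def by (simp add: nn_integral_count_space_times countable_labels)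
  also have "\<dots> = (\<integral>\<^sup>+ p. \<integral>\<^sup>+ \<omega>. f t (fst p) \<omega> * f ?u (snd p) \<omega> \<partial>M \<partial>count_space (labels \<times> labels))"
    using f by (intro nn_integral_count_space_nn_integral) (auto simp: countable_labels)
  also have "\<dots> = (\<Sum>n m. \<Sum>k = 0..min n m.
      \<integral>\<^sup>+ p. \<integral>\<^sup>+ \<omega>. f t (fst p) \<omega> * f ?u (snd p) \<omega> \<partial>M \<partial>count_space (label_pairs n m k))"
    by (rule nn_integral_label_pairs)
  also have "\<dots> = (\<Sum>n'. \<Sum>m'. let n = Suc n'; m = Suc m' in
       \<Sum>k = 0..min n m - 1.
         \<integral>\<^sup>+ \<omega>. of_nat (A n m k \<omega>) *
               indicator {\<omega>. S (n - 1) \<omega> \<le> t \<and> S' k (m - 1) \<omega> \<le> ?u} \<omega> \<partial>P)" (is "_ = ?R")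
    \<comment> \<open>After the shift by one, \<open>min n m - 1\<close> is the smaller of the two
      label lengths, so every \<open>k\<close> in the sum satisfies the bounds needed for the pair
      formula.\<close>
    by (simp add: Let_def f_def A_def S_def S'_def nn_integral_label_pairs_division_weight)
  finally have prod: "(\<integral>\<^sup>+ \<omega>. a t \<omega> * a ?u \<omega> \<partial>M) = ?R" .
  have "AE \<omega> in M. N t \<omega> * N ?u \<omega> = 1 + a t \<omega> + a ?u \<omega> + a t \<omega> * a ?u \<omega>"
    using N[of t] N[of ?u] by (auto simp: algebra_simps)
  then have "(\<integral>\<^sup>+ \<omega>. N t \<omega> * N ?u \<omega> \<partial>M) =
      1 + (\<integral>\<^sup>+ \<omega>. a t \<omega> \<partial>M) + (\<integral>\<^sup>+ \<omega>. a ?u \<omega> \<partial>M) + (\<integral>\<^sup>+ \<omega>. a t \<omega> * a ?u \<omega> \<partial>M)"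
    by (subst nn_integral_cong_AE, assumption) (simp add: nn_integral_add tree.emeasure_space_1)
  \<comment> \<open>The two mean identities contribute 1 each; removing one of them is exact for
    \<open>ennreal\<close> subtraction because 1 is finite.\<close>
  also have "1 + (\<integral>\<^sup>+ \<omega>. a t \<omega> \<partial>M) + (\<integral>\<^sup>+ \<omega>. a ?u \<omega> \<partial>M) =
      (\<integral>\<^sup>+ \<omega>. N t \<omega> \<partial>M) + (\<integral>\<^sup>+ \<omega>. N ?u \<omega> \<partial>M) - 1"
    by (simp add: EN add.assoc)
  finally show ?thesis unfolding prod .
qed

end
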